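(* Let $A$ be the following deterministic online algorithm with a buffer of size $4M$: it reads elements until its buffer is full; then, repeatedly at each decision point, it uses its buffer contents to determine which of the maximal increasing run and the maximal decreasing run that an algorithm with buffer size $M$ would write next on the current unwritten-element sequence is longer, and then, using its full $4M$-size buffer, writes a maximal run in that direction (increasing if the $M$-buffer maximal increasing run is longer, otherwise decreasing); it stops when no elements are left. Then for every input $I$ with no duplicate elements, $A$ writes no more runs than $\mathrm{OPT}_M(I)$, the optimal number of runs for an algorithm with buffer size $M$.
   Context: Up-down run generation problem: an input stream $I$ of elements from a totally ordered set is presented in order to an algorithm with a buffer of $B$ slots; the algorithm reads elements in order into the buffer and writes elements from the buffer to an output sequence, each write freeing a slot that is filled by the next input element. A run is a sorted or reverse-sorted sequence; the number of runs of an output $S$ is the smallest $k$ such that $S$ is a concatenation of $k$ runs. $\mathrm{OPT}_M(I)$ is the minimum number of runs of any output achievable on $I$ with buffer size $M$. A maximal increasing run (for a given buffer) is written by starting with the smallest buffered element, always writing the smallest buffered element larger than the last element written, and ending only when every buffered element is smaller than the last written; maximal decreasing runs are symmetric. The unwritten-element sequence is the buffer contents (in arrival order) followed by the unread input. A decision point is the start or any time a run has just ended. *)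

theory Defs
  imports Main
begin

text \<open>
  The state of an algorithm is its unwritten-element sequence \<open>us\<close>: buffer contents in arrival
  order, followed by the unread input. As every write is followed by a read of the next input
  element, a buffer with \<open>B\<close> slots always holds exactly the elements \<open>take B us\<close>, and writing
  \<open>x\<close> from it turns \<open>us\<close> into \<open>remove1 x us\<close>.
\<close>

inductive can_output :: "nat \<Rightarrow> 'a list \<Rightarrow> 'a list \<Rightarrow> bool" for B :: nat where
  all_written: "can_output B [] []"
| write_elem: "x \<in> set (take B us) \<Longrightarrow> can_output B (remove1 x us) S \<Longrightarrow> can_output B us (x # S)"

definition is_run :: "'a::linorder list \<Rightarrow> bool" where
  "is_run r \<longleftrightarrow> sorted r \<or> sorted (rev r)"

definition num_runs :: "'a::linorder list \<Rightarrow> nat" where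
  "num_runs S = (LEAST k. \<exists>rs. length rs = k \<and> (\<forall>r\<in>set rs. is_run r) \<and> concat rs = S)"

definition OPT :: "nat \<Rightarrow> 'a::linorder list \<Rightarrow> nat" where
  "OPT M I = (LEAST k. \<exists>S. can_output M I S \<and> num_runs S = k)"

datatype direction = Increasing | Decreasing

fun first_in :: "direction \<Rightarrow> 'a::linorder set \<Rightarrow> 'a" where
  "first_in Increasing X = Min X"
| "first_in Decreasing X = Max X"

fun beyond :: "direction \<Rightarrow> 'a::linorder \<Rightarrow> 'a set \<Rightarrow> 'a set" where
  "beyond Increasing l X = {x \<in> X. l < x}"
| "beyond Decreasing l X = {x \<in> X. x < l}"

lemma first_in_mem: "finite X \<Longrightarrow> X \<noteq> {} \<Longrightarrow> first_in d X \<in> X"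
  by (cases d) auto

lemma beyond_subset: "beyond d l X \<subseteq> X"
  by (cases d) auto

lemma first_in_beyond_mem:
  assumes "beyond d l (set (take B us)) \<noteq> {}"
  shows "first_in d (beyond d l (set (take B us))) \<in> set us"
proof -
  have "finite (beyond d l (set (take B us)))"
    by (rule finite_subset[OF beyond_subset]) simp
  from first_in_mem[OF this assms]
  have "first_in d (beyond d l (set (take B us))) \<in> set (take B us)"
    by (rule subsetD[OF beyond_subset])
  then show ?thesis
    by (rule in_set_takeD)
qed

text \<open>\<open>continue_run d B l us\<close>: what is still written of a maximal run whose last element was \<open>l\<close>.\<close>

function continue_run :: "direction \<Rightarrow> nat \<Rightarrow> 'a::linorder \<Rightarrow> 'a list \<Rightarrow> 'a list" where
  "continue_run d B l us =
    (let C = beyond d l (set (take B us)); x = first_in d C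
     in if C = {} then [] else x # continue_run d B x (remove1 x us))"
  by pat_completeness auto
termination
proof (relation "measure (\<lambda>(d, B, l, us). length us)", goal_cases)
  case (2 d B l us C x)
  have "beyond d l (set (take B us)) \<noteq> {}"
    using 2 by simp
  then have "x \<in> set us"
    unfolding 2 by (rule first_in_beyond_mem)
  then have "length (remove1 x us) < length us"
    by (metis length_remove1 length_pos_if_in_set diff_less zero_less_one)
  then show ?case
    by simp
qed simp

declare continue_run.simps [simp del]

definition maximal_run :: "direction \<Rightarrow> nat \<Rightarrow> 'a::linorder list \<Rightarrow> 'a list" where
  "maximal_run d B us =
    (if take B us = [] then []
     else let x = first_in d (set (take B us)) in x # continue_run d B x (remove1 x us))"

definition longer_direction :: "nat \<Rightarrow> 'a::linorder list \<Rightarrow> direction" where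
  "longer_direction M us =
    (if length (maximal_run Increasing M us) > length (maximal_run Decreasing M us)
     then Increasing else Decreasing)"

lemma length_fold_remove1: "length (fold remove1 r us) \<le> length us"
proof (induction r arbitrary: us)
  case (Cons x r)
  have "length (fold remove1 (x # r) us) \<le> length (remove1 x us)"
    using Cons by simp
  also have "\<dots> \<le> length us"
    by (simp add: length_remove1)
  finally show ?case .
qed simp

lemma length_after_maximal_run:
  assumes "us \<noteq> []" "B \<noteq> 0"
  shows "length (fold remove1 (maximal_run d B us) us) < length us"
proof -
  define x where "x = first_in d (set (take B us))"
  have "x \<in> set us"
    unfolding x_def using first_in_mem[of "set (take B us)" d] assms set_take_subset[of B us] by auto
  then have "length (remove1 x us) < length us"
    by (metis length_remove1 length_pos_if_in_set diff_less zero_less_one)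
  then show ?thesis
    using assms length_fold_remove1[of "continue_run d B x (remove1 x us)" "remove1 x us"]
    by (simp add: maximal_run_def Let_def x_def)
qed

text \<open>
  The runs written by the algorithm with \<open>B\<close> slots that, at each decision point, writes a maximal
  run in the direction that \<open>decide\<close> computes from the buffer contents alone. The case \<open>B = 0\<close>,
  in which nothing can be written, only makes the function total.
\<close>

function written_runs :: "('a::linorder list \<Rightarrow> direction) \<Rightarrow> nat \<Rightarrow> 'a list \<Rightarrow> 'a list list" where
  "written_runs decide B us =
    (if us = [] \<or> B = 0 then []
     else let r = maximal_run (decide (take B us)) B us
          in r # written_runs decide B (fold remove1 r us))"
  by pat_completeness auto
termination
proof (relation "measure (\<lambda>(decide, B, us). length us)", goal_cases)
  case (2 decide B us r)
  then have "us \<noteq> []" "B \<noteq> 0"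
    by simp_all
  then have "length (fold remove1 r us) < length us"
    unfolding 2 by (rule length_after_maximal_run)
  then show ?case
    by simp
qed simp

declare written_runs.simps [simp del]

text \<open>
  The direction is chosen by simulating the buffer of size \<open>M\<close> on the \<open>4 * M\<close> buffered elements.
\<close>

definition algA_output :: "nat \<Rightarrow> 'a::linorder list \<Rightarrow> 'a list" where
  "algA_output M I = concat (written_runs (longer_direction M) (4 * M) I)"

end

theory Submission
  imports Defs
begin

text \<open>
  Two runs of opposite directions that a buffer of size \<open>M\<close> can write on the same sequence cannot
  both be longer than \<open>3 * M\<close>: after \<open>M + 1\<close> writes they have crossed, and from then on every
  arriving element is lost for at least one of them, while fewer than \<open>M\<close> elements can be stuck in
  either buffer. Hence the \<open>4 * M\<close> buffered elements determine the longer direction, and a run of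
  the optimal algorithm against that direction has length at most \<open>3 * M\<close>, so it consists of
  elements that already are in the large buffer; all of these are written by the next maximal run,
  whatever its direction. A run of the optimal algorithm in the chosen direction is covered by the
  maximal run of the larger buffer. So every run of \<open>A\<close> covers the next run of the optimal
  algorithm, whose remaining output can be restricted to the elements that \<open>A\<close> has not yet written.
\<close>

section \<open>Directions as strict orders\<close>

text \<open>One strict linear order per direction, so that each argument about runs is made once for
  both.\<close>

fun before :: "direction \<Rightarrow> 'a::linorder \<Rightarrow> 'a \<Rightarrow> bool" where
  "before Increasing x y \<longleftrightarrow> x < y"
| "before Decreasing x y \<longleftrightarrow> y < x"

lemma before_irrefl [simp]: "\<not> before d x x"
  by (cases d) auto

lemma before_trans: "before d x y \<Longrightarrow> before d y z \<Longrightarrow> before d x z"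
  by (cases d) auto

lemma before_linear: "before d x y \<or> x = y \<or> before d y x"
  by (cases d) auto

lemma beyond_eq: "beyond d l X = {x \<in> X. before d l x}"
  by (cases d) auto

lemma first_in_least:
  assumes "finite X" "y \<in> X"
  shows "\<not> before d y (first_in d X)"
  using assms by (cases d) (auto simp: not_less)

lemma distinct_if_sorted_before: "sorted_wrt (before d) r \<Longrightarrow> distinct r"
  by (induction r) auto

lemma is_run_if_sorted_before: "sorted_wrt (before d) r \<Longrightarrow> is_run r"
proof (cases d)
  case Increasing
  moreover assume "sorted_wrt (before d) r"
  ultimately have "sorted_wrt (\<le>) r"
    by (auto elim!: sorted_wrt_mono_rel[rotated])
  then show ?thesis
    by (simp add: is_run_def)
next
  case Decreasing
  moreover assume "sorted_wrt (before d) r"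
  ultimately have "sorted_wrt (\<lambda>x y. y \<le> x) r"
    by (auto elim!: sorted_wrt_mono_rel[rotated])
  then show ?thesis
    by (simp add: is_run_def sorted_wrt_rev)
qed

lemma sorted_before_if_is_run:
  assumes "is_run r" "distinct r"
  obtains d where "sorted_wrt (before d) r"
proof -
  from assms(1) consider "sorted r" | "sorted (rev r)"
    by (auto simp: is_run_def)
  then show thesis
  proof cases
    case 1
    with assms(2) have "sorted_wrt (<) r"
      by (simp add: strict_sorted_iff)
    then show thesis
      by (intro that[of Increasing]) (auto elim!: sorted_wrt_mono_rel[rotated])
  next
    case 2
    with assms(2) have "sorted_wrt (<) (rev r)"
      by (simp add: strict_sorted_iff)
    then have "sorted_wrt (\<lambda>x y. y < x) r"
      by (simp add: sorted_wrt_rev)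
    then show thesis
      by (intro that[of Decreasing]) (auto elim!: sorted_wrt_mono_rel[rotated])
  qed
qed

section \<open>Sequences that a buffer can write\<close>

text \<open>In contrast to \<open>can_output\<close>, nothing forces \<open>us\<close> to be
  exhausted, so a single run can be studied apart from the rest of the output.\<close>

fun writable :: "nat \<Rightarrow> 'a list \<Rightarrow> 'a list \<Rightarrow> bool" where
  "writable B us [] \<longleftrightarrow> True"
| "writable B us (x # r) \<longleftrightarrow> x \<in> set (take B us) \<and> writable B (remove1 x us) r"

lemma set_take_remove1_subset: "set (take n (remove1 x us)) \<subseteq> set (take (Suc n) us)"
proof (induction us arbitrary: n)
  case (Cons u us)
  have "set (take n us) \<subseteq> set (take (Suc n) us)"
    by (simp add: set_take_subset_set_take)
  then show ?case
    using Cons[of "n - 1"] by (cases n) auto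
qed simp

lemma take_remove1:
  "x \<in> set (take (Suc n) us) \<Longrightarrow> take n (remove1 x us) = remove1 x (take (Suc n) us)"
proof (induction us arbitrary: n)
  case (Cons u us)
  then show ?case
    by (cases n) auto
qed simp

lemma in_set_take_remove1:
  assumes "x \<in> set (take (Suc n) us)" "w \<in> set (take (Suc n) us)" "x \<noteq> w"
  shows "x \<in> set (take n (remove1 w us))"
  using assms by (simp add: take_remove1)

lemma writable_take: "writable B us r \<Longrightarrow> writable B us (take k r)"
  by (induction r arbitrary: us k) (auto simp: take_Cons split: nat.split)

text \<open>Each write lets in at most one further element, so the \<open>k\<close>-th write sees at
  most the first \<open>B + k - 1\<close> elements.\<close>

lemma set_writable:
  assumes "writable B us r" "0 < B"
  shows "set r \<subseteq> set (take (B + length r - 1) us)"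
  using assms(1)
proof (induction r arbitrary: us)
  case (Cons x r)
  have "set r \<subseteq> set (take (B + length r) us)"
    using Cons.IH[of "remove1 x us"] Cons.prems
      set_take_remove1_subset[of "B + length r - 1" x us] assms(2) by auto
  moreover have "set (take B us) \<subseteq> set (take (B + length r) us)"
    by (simp add: set_take_subset_set_take)
  ultimately show ?case
    using Cons.prems by auto
qed simp

lemma set_take_writable:
  assumes "writable B us r" "0 < B" "n + 1 = B + k"
  shows "set (take k r) \<subseteq> set (take n us)"
proof -
  have "set (take k r) \<subseteq> set (take (B + length (take k r) - 1) us)"
    using writable_take[OF assms(1)] assms(2) by (rule set_writable)
  also have "\<dots> \<subseteq> set (take n us)"
    using assms(3) by (intro set_take_subset_set_take) simp
  finally show ?thesis .
qed

lemma distinct_writable: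
  assumes "writable B us r" "distinct us"
  shows "distinct r"
proof -
  have "set r \<subseteq> set us \<and> distinct r"
    using assms
  proof (induction r arbitrary: us)
    case (Cons x r)
    then have "set r \<subseteq> set us - {x} \<and> distinct r"
      by (metis distinct_remove1 set_remove1_eq writable.simps(2))
    then show ?case
      using Cons.prems by (auto dest: in_set_takeD)
  qed simp
  then show ?thesis ..
qed

lemma can_output_append:
  "can_output B us (r @ S) \<Longrightarrow> writable B us r \<and> can_output B (fold remove1 r us) S"
  by (induction r arbitrary: us) (auto elim: can_output.cases)

lemma can_output_self:
  assumes "0 < B"
  shows "can_output B us us"
proof (induction us)
  case (Cons u us)
  then show ?case
    using assms by (auto intro!: can_output.intros simp: take_Cons')
qed (rule can_output.intros)

lemma in_take_filter: "x \<in> set (take B us) \<Longrightarrow> P x \<Longrightarrow> x \<in> set (take B (filter P us))"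
proof (induction us arbitrary: B)
  case (Cons u us)
  then obtain B' where "B = Suc B'"
    by (cases B) auto
  with Cons show ?case
    using set_take_subset_set_take[of B' "Suc B'" "filter P us"] by auto
qed simp

text \<open>Dropping elements only moves the survivors forward, so each surviving write is still
  possible in its turn. This is how the elements already written by the larger buffer are struck
  from an optimal output.\<close>

lemma can_output_filter: "can_output B us S \<Longrightarrow> can_output B (filter P us) (filter P S)"
proof (induction rule: can_output.induct)
  case all_written
  show ?case
    by (simp add: can_output.all_written)
next
  case (write_elem x us S)
  then show ?case
    by (auto simp: filter_remove1 remove1_idem intro!: can_output.write_elem in_take_filter)
qed

lemma fold_remove1_eq_filter:
  "distinct us \<Longrightarrow> fold remove1 r us = filter (\<lambda>x. x \<notin> set r) us"
proof (induction r arbitrary: us)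
  case (Cons x r)
  then show ?case
    by (simp add: distinct_remove1_removeAll removeAll_filter_not_eq conj_commute)
      (rule filter_cong, auto)
qed simp

section \<open>Maximal runs\<close>

lemma continue_run_cases:
  obtains (stop) "continue_run d B l us = []" "\<And>x. x \<in> set (take B us) \<Longrightarrow> \<not> before d l x"
  | (step) w where "w \<in> set (take B us)" "before d l w"
      "\<And>x. x \<in> set (take B us) \<Longrightarrow> before d l x \<Longrightarrow> \<not> before d x w"
      "w = first_in d (beyond d l (set (take B us)))"
      "continue_run d B l us = w # continue_run d B w (remove1 w us)"
proof (cases "beyond d l (set (take B us)) = {}")
  case True
  then show thesis
    by (intro stop) (auto simp: continue_run.simps[of d B l us] beyond_eq)
next
  case False
  let ?C = "beyond d l (set (take B us))"
  have fin: "finite ?C"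
    by (simp add: beyond_eq)
  from first_in_mem[OF this False] have "first_in d ?C \<in> ?C" .
  then show thesis
    using False first_in_least[OF fin, of _ d]
    by (intro step[of "first_in d ?C"]) (auto simp: continue_run.simps[of d B l us] beyond_eq Let_def)
qed

lemma maximal_run_cases:
  obtains (stop) "maximal_run d B us = []" "take B us = []"
  | (step) w where "w \<in> set (take B us)"
      "\<And>x. x \<in> set (take B us) \<Longrightarrow> \<not> before d x w"
      "w = first_in d (set (take B us))"
      "maximal_run d B us = w # continue_run d B w (remove1 w us)"
proof (cases "take B us = []")
  case True
  then show thesis
    by (intro stop) (auto simp: maximal_run_def)
next
  case False
  then have "first_in d (set (take B us)) \<in> set (take B us)"
    by (intro first_in_mem) auto
  then show thesis
    using False first_in_least[of "set (take B us)" _ d]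
    by (intro step[of "first_in d (set (take B us))"]) (auto simp: maximal_run_def Let_def)
qed

lemma continue_run_sorted_writable:
  "sorted_wrt (before d) (l # continue_run d B l us) \<and> writable B us (continue_run d B l us)"
proof (induction "length us" arbitrary: l us rule: less_induct)
  case less
  show ?case
  proof (cases rule: continue_run_cases[of d B l us])
    case (step w)
    then have "length (remove1 w us) < length us"
      by (metis in_set_takeD length_remove1 length_pos_if_in_set diff_less zero_less_one)
    from less[OF this, of w] step show ?thesis
      by (auto intro: before_trans)
  qed simp
qed

lemma maximal_run_sorted_writable:
  "sorted_wrt (before d) (maximal_run d B us) \<and> writable B us (maximal_run d B us)"
proof (cases rule: maximal_run_cases[of d B us])
  case (step w)
  with continue_run_sorted_writable[of d w B "remove1 w us"] show ?thesis
    by simp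
qed simp

lemmas maximal_run_sorted = maximal_run_sorted_writable[THEN conjunct1]
  and maximal_run_writable = maximal_run_sorted_writable[THEN conjunct2]

text \<open>
  \<open>length (filter (\<lambda>y. before d y x) r)\<close> writes precede the moment at which a run \<open>r\<close> reaches \<open>x\<close>,
  so the premise on \<open>x\<close> says that \<open>x\<close> arrives in the buffer before the run has passed it.
\<close>

lemma in_continue_run:
  assumes "before d l x"
    and "x \<in> set (take (B + length (filter (\<lambda>y. before d y x) (continue_run d B l us))) us)"
  shows "x \<in> set (continue_run d B l us)"
  using assms
proof (induction "length us" arbitrary: l us rule: less_induct)
  case less
  show ?case
  proof (cases rule: continue_run_cases[of d B l us])
    case stop
    then show ?thesis
      using less.prems by auto
  next
    case (step w)
    let ?r = "continue_run d B w (remove1 w us)"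
    let ?n = "length (filter (\<lambda>y. before d y x) ?r)"
    consider "x = w" | "before d w x" "x \<noteq> w" | "before d x w"
      using before_linear by force
    then show ?thesis
    proof cases
      case 1
      then show ?thesis
        using step by simp
    next
      \<comment> \<open>\<open>w\<close> is one of the counted writes; removing it shortens both the
        count and the prefix holding \<open>x\<close> by one, so the premise carries over.\<close>
      case 2
      have "w \<in> set (take (Suc (B + ?n)) us)"
        using step(1) set_take_subset_set_take[of B "Suc (B + ?n)" us] by auto
      then have "x \<in> set (take (B + ?n) (remove1 w us))"
        using less.prems(2) 2 step(5) by (intro in_set_take_remove1) auto
      moreover have "length (remove1 w us) < length us"
        using step(1)
        by (metis in_set_takeD length_remove1 length_pos_if_in_set diff_less zero_less_one)
      ultimately have "x \<in> set ?r"
        using less.hyps 2(1) by blast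
      then show ?thesis
        using step(5) by simp
    next
      \<comment> \<open>The run is past \<open>x\<close> once \<open>w\<close> is written, so the
        count is 0 and \<open>x\<close> is in the buffer now, contradicting the choice of
        \<open>w\<close>.\<close>
      case 3
      have "\<forall>y \<in> set (w # ?r). \<not> before d y x"
        using continue_run_sorted_writable[of d w B "remove1 w us"] 3
        by simp (metis before_irrefl before_trans)
      then have "filter (\<lambda>y. before d y x) (continue_run d B l us) = []"
        using step(5) by (simp only: filter_empty_conv)
      then show ?thesis
        using less.prems 3 step(3) by simp
    qed
  qed
qed

text \<open>At the start of a run every buffered element is eligible, so no condition relative to a
  last element appears.\<close>

lemma in_maximal_run:
  assumes "x \<in> set (take (B + length (filter (\<lambda>y. before d y x) (maximal_run d B us))) us)"
  shows "x \<in> set (maximal_run d B us)"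
proof (cases rule: maximal_run_cases[of d B us])
  case stop
  then show ?thesis
    using assms by auto
next
  case (step w)
  let ?r = "continue_run d B w (remove1 w us)"
  let ?n = "length (filter (\<lambda>y. before d y x) ?r)"
  consider "x = w" | "before d w x" "x \<noteq> w" | "before d x w"
    using before_linear by force
  then show ?thesis
  proof cases
    case 1
    then show ?thesis
      using step by simp
  next
    case 2
    have "w \<in> set (take (Suc (B + ?n)) us)"
      using step(1) set_take_subset_set_take[of B "Suc (B + ?n)" us] by auto
    then have "x \<in> set (take (B + ?n) (remove1 w us))"
      using assms 2 step(4) by (intro in_set_take_remove1) auto
    with 2(1) have "x \<in> set ?r"
      by (rule in_continue_run)
    then show ?thesis
      using step(4) by simp
  next
    case 3
    have "\<forall>y \<in> set (w # ?r). \<not> before d y x"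
      using continue_run_sorted_writable[of d w B "remove1 w us"] 3
      by simp (metis before_irrefl before_trans)
    then have "filter (\<lambda>y. before d y x) (maximal_run d B us) = []"
      using step(4) by (simp only: filter_empty_conv)
    then show ?thesis
      using assms 3 step(2) by simp
  qed
qed

text \<open>An element present at the start is there before any write, so the run cannot have passed
  it.\<close>

lemma buffer_subset_maximal_run: "set (take B us) \<subseteq> set (maximal_run d B us)"
  using in_maximal_run[of _ B d us] set_take_subset_set_take[of B _ us] by (meson le_add1 subsetD subsetI)

text \<open>Induction on arrival order. Before \<open>r\<close> can write \<open>x\<close>, it must
  have written enough earlier arrivals to let \<open>x\<close> in; these precede \<open>x\<close> in
  the direction and, by induction, are also written by the maximal run, so \<open>x\<close> reaches
  the larger buffer before that run passes it.\<close>

lemma maximal_run_covers: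
  assumes "writable M us r" "sorted_wrt (before d) r" "distinct us" "0 < M" "M \<le> B"
  shows "set r \<subseteq> set (maximal_run d B us)"
proof -
  let ?p = "maximal_run d B us"
  have "set r \<inter> set (take n us) \<subseteq> set ?p" for n
  proof (induction n)
    case (Suc n)
    have "us ! n \<in> set ?p" if n: "n < length us" and x: "us ! n \<in> set r"
    proof (rule in_maximal_run)
      let ?x = "us ! n"
      \<comment> \<open>A buffer of size \<open>M\<close> must make \<open>k\<close> writes before
        the element at index \<open>n\<close> enters; \<open>k\<close> is 0 for elements present at
        the start.\<close>
      define k where "k = n + 1 - M"
      have "n + 1 \<le> B + length (filter (\<lambda>y. before d y ?x) ?p)"
      proof (cases "k = 0")
        case False
        have "set (take k r) \<subseteq> set (take n us)"
          using assms(1,4) False by (intro set_take_writable) (auto simp: k_def)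
        moreover have "?x \<notin> set (take n us)"
          using n distinct_take[OF assms(3), of "Suc n"] by (simp add: take_Suc_conv_app_nth)
        ultimately have "?x \<notin> set (take k r)"
          by blast
        moreover have "set r = set (take k r) \<union> set (drop k r)"
          by (metis append_take_drop_id set_append)
        ultimately have x': "?x \<in> set (drop k r)"
          using x by auto
        then have k: "k < length r"
          by (cases "k < length r") auto
        have "\<forall>y \<in> set (take k r). before d y ?x"
          using assms(2) x' sorted_wrt_append[of "before d" "take k r" "drop k r"] by auto
        then have sub: "set (take k r) \<subseteq> set (filter (\<lambda>y. before d y ?x) ?p)"
          using Suc.IH \<open>set (take k r) \<subseteq> set (take n us)\<close> set_take_subset[of k r] by auto
        have "k = card (set (take k r))"
          using k distinct_if_sorted_before[OF assms(2)] by (simp add: distinct_card)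
        also have "\<dots> \<le> card (set (filter (\<lambda>y. before d y ?x) ?p))"
          using sub by (intro card_mono) auto
        also have "\<dots> \<le> length (filter (\<lambda>y. before d y ?x) ?p)"
          by (rule card_length)
        finally show ?thesis
          using assms(5) by (simp add: k_def)
      qed (use assms(5) in \<open>simp add: k_def\<close>)
      moreover have "?x \<in> set (take (n + 1) us)"
        using n by (simp add: take_Suc_conv_app_nth)
      ultimately show "?x \<in> set (take (B + length (filter (\<lambda>y. before d y ?x) ?p)) us)"
        by (rule subsetD[OF set_take_subset_set_take])
    qed
    moreover have "set (take (Suc n) us) \<subseteq> insert (us ! n) (set (take n us))" if "n < length us"
      using that by (simp add: take_Suc_conv_app_nth)
    moreover have "take (Suc n) us = take n us" if "\<not> n < length us"
      using that by simp
    ultimately show ?case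
      using Suc.IH by (cases "n < length us") (blast, metis)
  qed simp
  from this[of "M + length r - 1"] set_writable[OF assms(1,4)] show ?thesis
    by blast
qed

section \<open>The longer direction\<close>

text \<open>At most \<open>B + j\<close> elements have been seen when write number
  \<open>j + 1\<close> is due, so these determine the first \<open>j + 1\<close> writes or an
  earlier end of the run.\<close>

lemma take_continue_run:
  "take (Suc j) (continue_run d B l (take (B + j) us)) = take (Suc j) (continue_run d B l us)"
proof (induction j arbitrary: l us)
  case 0
  then show ?case
    by (simp add: continue_run.simps[of d B l] Let_def)
next
  case (Suc j)
  have *: "take B (take (B + Suc j) us) = take B us"
    by simp
  show ?case
  proof (cases rule: continue_run_cases[of d B l us])
    case stop
    then have "beyond d l (set (take B us)) = {}"
      by (auto simp: beyond_eq)
    then show ?thesis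
      by (simp add: continue_run.simps[of d B l])
  next
    case (step w)
    then have C: "beyond d l (set (take B us)) \<noteq> {}"
      by (auto simp: beyond_eq)
    have "w \<in> set (take (Suc (B + j)) us)"
      using step(1) set_take_subset_set_take[of B "Suc (B + j)" us] by auto
    then have "remove1 w (take (B + Suc j) us) = take (B + j) (remove1 w us)"
      by (simp add: take_remove1)
    with C step(4) have "continue_run d B l (take (B + Suc j) us) =
        w # continue_run d B w (take (B + j) (remove1 w us))"
      unfolding continue_run.simps[of d B l "take (B + Suc j) us"] * by (simp add: Let_def)
    then show ?thesis
      using step(5) Suc.IH by simp
  qed
qed

lemma take_maximal_run:
  "take (Suc j) (maximal_run d B (take (B + j) us)) = take (Suc j) (maximal_run d B us)"
proof (cases j)
  case 0
  then show ?thesis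
    by (simp add: maximal_run_def Let_def)
next
  case (Suc i)
  have *: "take B (take (B + Suc i) us) = take B us"
    by simp
  show ?thesis
  proof (cases rule: maximal_run_cases[of d B us])
    case stop
    then show ?thesis
      unfolding Suc maximal_run_def * by simp
  next
    case (step w)
    have "w \<in> set (take (Suc (B + i)) us)"
      using step(1) set_take_subset_set_take[of B "Suc (B + i)" us] by auto
    then have "remove1 w (take (B + Suc i) us) = take (B + i) (remove1 w us)"
      by (simp add: take_remove1)
    moreover have "take B us \<noteq> []"
      using step(1) by (metis empty_iff empty_set)
    ultimately have "maximal_run d B (take (B + Suc i) us) =
        w # continue_run d B w (take (B + i) (remove1 w us))"
      unfolding maximal_run_def * step(3) by (simp add: Let_def)
    then show ?thesis
      using step(4) take_continue_run[of i] by (simp add: Suc)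
  qed
qed

lemma sorted_wrt_split:
  assumes "sorted_wrt R r" "k < length r"
  shows "\<forall>x \<in> set (take (Suc k) r). x = r ! k \<or> R x (r ! k)"
    and "\<forall>x \<in> set (drop (Suc k) r). R (r ! k) x"
proof -
  have "sorted_wrt R (take k r @ r ! k # drop (Suc k) r)"
    using assms by (simp add: id_take_nth_drop[symmetric])
  then show "\<forall>x \<in> set (take (Suc k) r). x = r ! k \<or> R x (r ! k)"
    and "\<forall>x \<in> set (drop (Suc k) r). R (r ! k) x"
    using assms(2) by (auto simp: sorted_wrt_append take_Suc_conv_app_nth)
qed

text \<open>A count over the second half of the first \<open>4 * M\<close> elements: each of these
  \<open>2 * M\<close> elements is missed by one of the runs, yet a run longer than
  \<open>3 * M\<close> misses fewer than \<open>M\<close> of the first \<open>4 * M\<close>.\<close>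

lemma opposite_runs_not_both_long:
  assumes "distinct us" "0 < M" "4 * M \<le> length us"
    and "writable M us p" "sorted_wrt (before Increasing) p"
    and "writable M us q" "sorted_wrt (before Decreasing) q"
  shows "length p \<le> 3 * M \<or> length q \<le> 3 * M"
proof (rule ccontr)
  assume "\<not> ?thesis"
  then have len: "3 * M < length p" "3 * M < length q"
    by auto
  have p: "distinct p" "sorted_wrt (<) p" and q: "distinct q" "sorted_wrt (\<lambda>x y. y < x) q"
    using assms(5,7) by (auto intro: distinct_if_sorted_before elim!: sorted_wrt_mono_rel[rotated])
  have p_split: "\<forall>x \<in> set (take (Suc M) p). x \<le> p ! M"
      "\<forall>x \<in> set (drop (Suc M) p). p ! M < x"
    using sorted_wrt_split[OF p(2), of M] len by auto
  have q_split: "\<forall>x \<in> set (take (Suc M) q). q ! M \<le> x"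
      "\<forall>x \<in> set (drop (Suc M) q). x < q ! M"
    using sorted_wrt_split[OF q(2), of M] len by auto
  \<comment> \<open>Write number \<open>M + 1\<close> sees at most
    \<open>M + (M + 1) - 1 = 2 * M\<close> elements.\<close>
  have early: "set (take (Suc M) p) \<subseteq> set (take (2 * M) us)"
      "set (take (Suc M) q) \<subseteq> set (take (2 * M) us)"
    using set_take_writable[OF assms(4,2), of "2 * M" "Suc M"]
      set_take_writable[OF assms(6,2), of "2 * M" "Suc M"] by simp_all
  \<comment> \<open>Otherwise the first \<open>M + 1\<close> writes of both runs would be
    \<open>2 * M + 2\<close> distinct elements among \<open>2 * M\<close>.\<close>
  have crossed: "q ! M \<le> p ! M"
  proof (rule ccontr)
    assume "\<not> ?thesis"
    then have "set (take (Suc M) p) \<inter> set (take (Suc M) q) = {}"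
      using p_split(1) q_split(1) by fastforce
    then have "card (set (take (Suc M) p) \<union> set (take (Suc M) q)) = 2 * Suc M"
      using p(1) q(1) len by (simp add: card_Un_disjoint distinct_card)
    moreover have "card (set (take (Suc M) p) \<union> set (take (Suc M) q)) \<le> card (set (take (2 * M) us))"
      using early by (intro card_mono) auto
    moreover have "card (set (take (2 * M) us)) \<le> 2 * M"
      using card_length[of "take (2 * M) us"] by simp
    ultimately show False
      by simp
  qed
  \<comment> \<open>These elements arrive too late for the first \<open>M + 1\<close> writes of
    either run.\<close>
  define E where "E = set (drop (2 * M) (take (4 * M) us))"
  have card_E: "card E = 2 * M"
    using assms(1,3) by (simp add: E_def distinct_card)
  have E_late: "E \<inter> set (take (2 * M) us) = {}"
    using assms(1) set_take_disj_set_drop_if_distinct[of us "2 * M" "2 * M"]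
    by (auto simp: E_def drop_take dest: in_set_takeD)
  have "E \<subseteq> (set (take (4 * M) us) - set p) \<union> (set (take (4 * M) us) - set q)"
  proof
    fix x
    assume x: "x \<in> E"
    then have "x \<in> set (take (4 * M) us)"
      by (auto simp: E_def dest: in_set_dropD)
    \<comment> \<open>A common element would lie above \<open>p ! M\<close> and below
      \<open>q ! M\<close>, which is at most \<open>p ! M\<close>.\<close>
    moreover have "x \<notin> set p \<or> x \<notin> set q"
    proof (rule ccontr)
      assume "\<not> ?thesis"
      moreover have "x \<notin> set (take (Suc M) p)" "x \<notin> set (take (Suc M) q)"
        using x E_late early by auto
      ultimately have "x \<in> set (drop (Suc M) p)" "x \<in> set (drop (Suc M) q)"
        by (metis Un_iff append_take_drop_id set_append)+
      with p_split(2) q_split(2) crossed show False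
        by force
    qed
    ultimately show "x \<in> (set (take (4 * M) us) - set p) \<union> (set (take (4 * M) us) - set q)"
      by blast
  qed
  then have "card E \<le> card ((set (take (4 * M) us) - set p) \<union> (set (take (4 * M) us) - set q))"
    by (intro card_mono) auto
  also have "\<dots> \<le> card (set (take (4 * M) us) - set p) + card (set (take (4 * M) us) - set q)"
    by (rule card_Un_le)
  finally have lost: "2 * M \<le> card (set (take (4 * M) us) - set p) + card (set (take (4 * M) us) - set q)"
    by (simp add: card_E)
  \<comment> \<open>The first \<open>3 * M + 1\<close> writes all come from the first
    \<open>4 * M\<close> elements, leaving only \<open>M - 1\<close> of them.\<close>
  have stuck: "card (set (take (4 * M) us) - set r) < M"
    if "writable M us r" "distinct r" "3 * M < length r" for r
  proof -
    have "card (set (take (4 * M) us) - set r) \<le> card (set (take (4 * M) us) - set (take (Suc (3 * M)) r))"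
      by (intro card_mono) (auto dest: in_set_takeD)
    also have "\<dots> = card (set (take (4 * M) us)) - card (set (take (Suc (3 * M)) r))"
      using that(1) assms(2) by (intro card_Diff_subset set_take_writable) auto
    also have "\<dots> = 4 * M - Suc (3 * M)"
      using that(2,3) assms(1,3) by (simp add: distinct_card)
    finally show ?thesis
      using assms(2) by simp
  qed
  from lost stuck[OF assms(4) p(1) len(1)] stuck[OF assms(6) q(1) len(2)] show False
    by linarith
qed

lemma maximal_runs_not_both_long:
  assumes "distinct us" "0 < M" "4 * M \<le> length us"
  shows "length (maximal_run Increasing M us) \<le> 3 * M \<or> length (maximal_run Decreasing M us) \<le> 3 * M"
  using opposite_runs_not_both_long[OF assms maximal_run_writable maximal_run_sorted
      maximal_run_writable maximal_run_sorted] .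

text \<open>Truncation preserves both run lengths up to the cap \<open>3 * M + 1\<close>. If at
  least \<open>4 * M\<close> elements remain, one run stays below the cap, so the capped lengths
  still decide the comparison.\<close>

lemma longer_direction_take:
  assumes "distinct us" "0 < M"
  shows "longer_direction M (take (4 * M) us) = longer_direction M us"
proof (cases "4 * M \<le> length us")
  case True
  have "min (length (maximal_run d M (take (4 * M) us))) (Suc (3 * M)) =
      min (length (maximal_run d M us)) (Suc (3 * M))" for d
    using arg_cong[OF take_maximal_run[of "3 * M" d M us], of length] by simp
  from this[of Increasing] this[of Decreasing] maximal_runs_not_both_long[OF assms True]
  show ?thesis
    by (auto simp: longer_direction_def min_def split: if_splits)
qed simp

lemma algA_run_covers:
  assumes "distinct us" "0 < M" "writable M us r" "is_run r"
  shows "set r \<subseteq> set (maximal_run (longer_direction M us) (4 * M) us)"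
proof -
  let ?d = "longer_direction M us"
  obtain d where d: "sorted_wrt (before d) r"
    using assms sorted_before_if_is_run distinct_writable by blast
  show ?thesis
  proof (cases "d = ?d \<or> \<not> 4 * M \<le> length us")
    case True
    then show ?thesis
    proof
      assume "d = ?d"
      then show ?thesis
        using assms d by (intro maximal_run_covers[of M]) auto
    next
      assume "\<not> 4 * M \<le> length us"
      then show ?thesis
        using buffer_subset_maximal_run[of "4 * M" us ?d] set_writable[OF assms(3,2)]
        by (auto dest: in_set_takeD)
    qed
  next
    case False
    \<comment> \<open>\<open>d\<close> is the rejected direction, so its maximal run is no longer
      than the other one and the bound applies to it.\<close>
    then have "length (maximal_run d M us) \<le> 3 * M"
      using maximal_runs_not_both_long[OF assms(1,2)]
      by (cases d) (auto simp: longer_direction_def split: if_splits)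
    moreover have "set r \<subseteq> set (maximal_run d M us)"
      using assms d by (intro maximal_run_covers[of M]) auto
    moreover have "set (maximal_run d M us) \<subseteq> set (take (M + length (maximal_run d M us) - 1) us)"
      using assms(2) by (intro set_writable maximal_run_writable)
    moreover have "set (take (M + length (maximal_run d M us) - 1) us) \<subseteq> set (take (4 * M) us)"
      using calculation(1) by (intro set_take_subset_set_take) simp
    ultimately have "set r \<subseteq> set (take (4 * M) us)"
      by blast
    then show ?thesis
      using buffer_subset_maximal_run by blast
  qed
qed

section \<open>Counting runs\<close>

lemma num_runs_le: "\<forall>r \<in> set rs. is_run r \<Longrightarrow> num_runs (concat rs) \<le> length rs"
  unfolding num_runs_def by (rule Least_le) auto

lemma num_runs_witness: "\<exists>rs. length rs = num_runs S \<and> (\<forall>r \<in> set rs. is_run r) \<and> concat rs = S"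
proof -
  \<comment> \<open>The division into singletons shows that \<open>LEAST\<close> ranges over a
    nonempty set.\<close>
  have "(\<forall>r \<in> set (map (\<lambda>x. [x]) S). is_run r) \<and> concat (map (\<lambda>x. [x]) S) = S"
    by (auto simp: is_run_def)
  then have "\<exists>k rs. length rs = k \<and> (\<forall>r \<in> set rs. is_run r) \<and> concat rs = S"
    by blast
  from LeastI_ex[OF this] show ?thesis
    unfolding num_runs_def .
qed

lemma is_run_filter: "is_run r \<Longrightarrow> is_run (filter P r)"
  by (auto simp: is_run_def rev_filter sorted_wrt_filter)

lemma is_run_written_runs: "r \<in> set (written_runs decide B us) \<Longrightarrow> is_run r"
proof (induction decide B us rule: written_runs.induct)
  case (1 decide B us)
  then show ?case
    using is_run_if_sorted_before[OF maximal_run_sorted]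
    by (subst (asm) written_runs.simps[of decide B us]) (auto simp: Let_def split: if_splits)
qed

text \<open>\<open>rs\<close> is an arbitrary division into runs: striking elements keeps the number
  of pieces, even if some become empty, while optimality need not persist through the
  induction.\<close>

lemma length_written_runs_le:
  assumes "0 < M" "distinct us" "can_output M us (concat rs)" "\<forall>r \<in> set rs. is_run r"
  shows "length (written_runs (longer_direction M) (4 * M) us) \<le> length rs"
  using assms(2-4)
proof (induction "length rs" arbitrary: us rs)
  case 0
  then have "us = []"
    by (auto elim: can_output.cases)
  then show ?case
    by (simp add: written_runs.simps)
next
  case (Suc n rrs us)
  then obtain r rs where rrs: "rrs = r # rs" "n = length rs"
    by (cases rrs) auto
  let ?p = "maximal_run (longer_direction M us) (4 * M) us"
  let ?P = "\<lambda>x. x \<notin> set ?p"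
  have r: "writable M us r" "can_output M (fold remove1 r us) (concat rs)"
    using can_output_append[of M us r "concat rs"] Suc.prems(2) rrs by auto
  have "set r \<subseteq> set ?p"
    using Suc.prems assms(1) r(1) rrs by (intro algA_run_covers) auto
  \<comment> \<open>Everything removed by \<open>r\<close> is in \<open>?p\<close>, so striking
    \<open>?p\<close> from what the \<open>M\<close>-buffer has left gives exactly what the larger
    buffer has left.\<close>
  then have "filter ?P (fold remove1 r us) = fold remove1 ?p us"
    using Suc.prems(1) by (auto simp: fold_remove1_eq_filter intro!: filter_cong)
  with can_output_filter[OF r(2), of ?P]
  have "can_output M (fold remove1 ?p us) (concat (map (filter ?P) rs))"
    by (simp add: filter_concat)
  moreover have "distinct (fold remove1 ?p us)"
    using Suc.prems(1) by (simp add: fold_remove1_eq_filter)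
  moreover have "\<forall>r \<in> set (map (filter ?P) rs). is_run r"
    using Suc.prems(3) rrs by (auto intro: is_run_filter)
  ultimately have "length (written_runs (longer_direction M) (4 * M) (fold remove1 ?p us)) \<le> length rs"
    using Suc.hyps(1)[of "map (filter ?P) rs"] rrs(2) by simp
  then show ?case
    using Suc.prems(1) assms(1) rrs(1)
    by (subst written_runs.simps) (simp add: Let_def longer_direction_take)
qed

text \<open>The first conjunct certifies that deciding from the \<open>4 * M\<close> buffered
  elements alone, as \<open>algA_output\<close> does, yields the direction defined by the whole
  unwritten sequence.\<close>

theorem theorem7:
  fixes M :: nat
  assumes "M \<ge> 1"
  shows "(\<forall>us :: 'a::linorder list. distinct us \<longrightarrow>
            longer_direction M (take (4 * M) us) = longer_direction M us) \<and>
         (\<forall>I :: 'a list. distinct I \<longrightarrow> num_runs (algA_output M I) \<le> OPT M I)"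
proof (intro conjI allI impI)
  show "longer_direction M (take (4 * M) us) = longer_direction M us"
    if "distinct us" for us :: "'a list"
    using that assms by (simp add: longer_direction_take)
next
  fix I :: "'a list"
  assume "distinct I"
  \<comment> \<open>Writing the elements in input order is a possible output, so the minimum in
    \<open>OPT\<close> is attained.\<close>
  have "\<exists>S. can_output M I S \<and> num_runs S = OPT M I"
    unfolding OPT_def by (rule LeastI_ex) (use can_output_self[of M I] assms in auto)
  then obtain S where S: "can_output M I S" "num_runs S = OPT M I"
    by blast
  obtain rs where rs: "length rs = OPT M I" "\<forall>r \<in> set rs. is_run r" "concat rs = S"
    using num_runs_witness[of S] S(2) by auto
  have "num_runs (algA_output M I) \<le> length (written_runs (longer_direction M) (4 * M) I)"
    unfolding algA_output_def by (intro num_runs_le ballI is_run_written_runs)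
  also have "\<dots> \<le> OPT M I"
    using length_written_runs_le[of M I rs] assms \<open>distinct I\<close> S rs by simp
  finally show "num_runs (algA_output M I) \<le> OPT M I" .
qed

end
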